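(* Let $X$ be an almost regular first-countable topological space satisfying the countable chain condition. Then $|X|\le\mathfrak{c}$, where $\mathfrak{c}=2^{\aleph_0}$.
   Context: A space $X$ is almost regular if for every non-empty open set $U\subset X$ there is a non-empty open set $V$ such that $\overline{V}\subset U$. The countable chain condition (ccc) means that every family of pairwise disjoint non-empty open sets is countable.
   Formalization: The space is additionally assumed to be Hausdorff; without a separation axiom the claim fails, e.g. for an indiscrete space of cardinality greater than the continuum, which is almost regular, first-countable and ccc. *)

theory Defs
  imports "HOL-Analysis.Analysis"
begin

(* Spaces are taken to be Hausdorff, the usual convention for cardinal functions. It is stated as a
   separate hypothesis because almost regularity implies no separation axiom: an indiscrete space
   of any cardinality is almost regular, first countable and ccc. *)

definition almost_regular_space :: "'a topology \<Rightarrow> bool" where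
  "almost_regular_space X \<longleftrightarrow>
     (\<forall>U. openin X U \<and> U \<noteq> {} \<longrightarrow>
        (\<exists>V. openin X V \<and> V \<noteq> {} \<and> X closure_of V \<subseteq> U))"

definition ccc_space :: "'a topology \<Rightarrow> bool" where
  "ccc_space X \<longleftrightarrow>
     (\<forall>\<U>. (\<forall>U \<in> \<U>. openin X U \<and> U \<noteq> {}) \<and> pairwise disjnt \<U> \<longrightarrow> countable \<U>)"

end

theory Submission
  imports Defs
begin

text \<open>
  The bound follows from a closing-off argument. Fix a countable base \<open>B x 0, B x 1, \<dots>\<close> of open
  neighbourhoods at every point \<open>x\<close>. Consider all sequences of families \<open>\<V>\<^sub>0, \<V>\<^sub>1, \<dots>\<close>, each made of
  countably many basic neighbourhoods, for which the closures of the unions \<open>\<Union>\<V>\<^sub>n\<close> fail to cover the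
  space; to each of them assign a point that is left uncovered. Such a sequence is given by countably
  many points and a set of triples of naturals, so the assignment amounts to continuum many operations
  of countable arity, and by \<open>closed_under_countable_operations\<close> some set \<open>H\<close> of at most continuum many
  points is closed under it.

  Then \<open>H\<close> is the whole space. Suppose that \<open>p\<close> lies outside \<open>H\<close>, and let \<open>\<U>\<^sub>n\<close> consist of the basic
  neighbourhoods of points of \<open>H\<close> that miss \<open>B p n\<close>. Because the space is Hausdorff, the families
  \<open>\<U>\<^sub>n\<close> together cover \<open>H\<close>. The countable chain condition supplies countable \<open>\<V>\<^sub>n \<subseteq> \<U>\<^sub>n\<close> with
  \<open>\<Union>\<U>\<^sub>n\<close> in the closure of \<open>\<Union>\<V>\<^sub>n\<close> (\<open>ccc_countable_subfamily_dense\<close>), so these closures cover \<open>H\<close> too.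
  None of them contains \<open>p\<close>, as \<open>B p n\<close> misses \<open>\<Union>\<V>\<^sub>n\<close>. Hence some point is left uncovered, and by the
  choice of \<open>H\<close> the point assigned to \<open>\<V>\<^sub>0, \<V>\<^sub>1, \<dots>\<close> is an uncovered point of \<open>H\<close>, a contradiction.
\<close>

section \<open>Closing a point off under operations of countable arity\<close>

text \<open>
  Formal terms over one constant and, for every set \<open>L\<close>, one operation symbol of arity \<open>\<omega>\<close>.
\<close>

datatype 'l cterm = Base | App "'l set" "nat \<Rightarrow> 'l cterm"

text \<open>
  A term is a well-founded tree, so it is described by the set of its inner nodes, an address being
  a list of child numbers, together with the labels at each of them. The entry \<open>None\<close> marks that an
  inner node is present, even if its label is the empty set.
\<close>

primrec cterm_code :: "'l cterm \<Rightarrow> (nat list \<times> 'l option) set" where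
  "cterm_code Base = {}"
| "cterm_code (App L f) =
     {([], None)} \<union> {([], Some l) |l. l \<in> L} \<union> {(k # ks, y) |k ks y. (ks, y) \<in> cterm_code (f k)}"

lemma cterm_code_eq_imp_eq: "cterm_code s = cterm_code t \<Longrightarrow> s = t"
proof (induction s arbitrary: t)
  case Base
  then show ?case
    by (cases t) auto
next
  case (App L f)
  obtain L' f' where t: "t = App L' f'"
    using App.prems by (cases t) auto
  have "l \<in> L \<longleftrightarrow> l \<in> L'" for l
  proof -
    have "([], Some l) \<in> cterm_code (App L f) \<longleftrightarrow> ([], Some l) \<in> cterm_code t"
      by (simp only: App.prems)
    then show ?thesis
      by (simp add: t)
  qed
  moreover have "f k = f' k" for k
  proof (rule App.IH)
    show "f k \<in> range f"
      by simp
    have "y \<in> cterm_code (f k) \<longleftrightarrow> y \<in> cterm_code (f' k)" for y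
    proof -
      have "(k # fst y, snd y) \<in> cterm_code (App L f) \<longleftrightarrow> (k # fst y, snd y) \<in> cterm_code t"
        by (simp only: App.prems)
      then show ?thesis
        by (simp add: t)
    qed
    then show "cterm_code (f k) = cterm_code (f' k)"
      by blast
  qed
  ultimately show ?case
    unfolding t by blast
qed

lemma cterm_lepoll_continuum: "(UNIV :: 'l::countable cterm set) \<lesssim> (UNIV :: nat set set)"
  unfolding lepoll_def
proof (intro exI conjI)
  show "inj (\<lambda>t :: 'l cterm. to_nat ` cterm_code t)"
    by (auto intro!: injI cterm_code_eq_imp_eq simp: inj_image_eq_iff)
qed auto

primrec cterm_eval :: "('l set \<Rightarrow> (nat \<Rightarrow> 'a) \<Rightarrow> 'a) \<Rightarrow> 'a \<Rightarrow> 'l cterm \<Rightarrow> 'a" where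
  "cterm_eval F a Base = a"
| "cterm_eval F a (App L f) = F L (\<lambda>k. cterm_eval F a (f k))"

text \<open>
  The values of all terms form the closure of \<open>a\<close>, and there are no more of them than terms. Working
  with terms replaces the usual recursion of length \<open>\<omega>\<^sub>1\<close>.
\<close>

lemma closed_under_countable_operations:
  fixes F :: "'l::countable set \<Rightarrow> (nat \<Rightarrow> 'a) \<Rightarrow> 'a"
  obtains H where "a \<in> H" "H \<lesssim> (UNIV :: nat set set)"
    "\<And>L s. range s \<subseteq> H \<Longrightarrow> F L s \<in> H"
proof
  let ?H = "range (cterm_eval F a)"
  show "a \<in> ?H"
    by (metis cterm_eval.simps(1) rangeI)
  show "?H \<lesssim> (UNIV :: nat set set)"
    using image_lepoll cterm_lepoll_continuum by (rule lepoll_trans)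
  show "F L s \<in> ?H" if "range s \<subseteq> ?H" for L s
  proof -
    have "\<forall>k. \<exists>t. s k = cterm_eval F a t"
      using that by blast
    then obtain f where "\<And>k. s k = cterm_eval F a (f k)"
      by metis
    then have "s = (\<lambda>k. cterm_eval F a (f k))"
      by (rule ext)
    then have "F L s = cterm_eval F a (App L f)"
      by simp
    then show ?thesis
      by blast
  qed
qed

section \<open>Countable families in spaces with the countable chain condition\<close>

text \<open>
  Take a maximal disjoint family of non-empty open sets that are each contained in a member of \<open>\<U>\<close>.
  It is countable, so countably many members of \<open>\<U>\<close> contain all its sets; if their union missed a
  neighbourhood of a point of \<open>\<Union>\<U>\<close>, the disjoint family could be enlarged.
\<close>

lemma ccc_countable_subfamily_dense:
  assumes ccc: "ccc_space X" and op: "\<And>U. U \<in> \<U> \<Longrightarrow> openin X U"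
  obtains \<V> where "countable \<V>" "\<V> \<subseteq> \<U>" "\<Union>\<U> \<subseteq> X closure_of \<Union>\<V>"
proof -
  define D where "D = {\<W>. (\<forall>W\<in>\<W>. openin X W \<and> W \<noteq> {} \<and> (\<exists>U\<in>\<U>. W \<subseteq> U)) \<and> pairwise disjnt \<W>}"
  have "\<exists>M\<in>D. \<forall>\<W>\<in>D. M \<subseteq> \<W> \<longrightarrow> \<W> = M"
  proof (rule subset_Zorn')
    fix C assume C: "subset.chain D C"
    then have "pairwise disjnt (\<Union>C)"
      by (intro pairwise_chain_Union)
         (auto simp: D_def subset_chain_def chain_subset_def)
    then show "\<Union>C \<in> D"
      using C by (auto simp: D_def subset_chain_def subset_iff)
  qed
  then obtain M where M: "M \<in> D" and max: "\<And>\<W>. \<W> \<in> D \<Longrightarrow> M \<subseteq> \<W> \<Longrightarrow> \<W> = M"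
    by blast
  have "countable M"
    using ccc M by (auto simp: ccc_space_def D_def)
  obtain u where u: "\<And>W. W \<in> M \<Longrightarrow> u W \<in> \<U> \<and> W \<subseteq> u W"
    using M unfolding D_def by (simp, metis)
  show thesis
  proof
    show "countable (u ` M)"
      using \<open>countable M\<close> by simp
    show "u ` M \<subseteq> \<U>"
      using u by blast
    show "\<Union>\<U> \<subseteq> X closure_of \<Union>(u ` M)"
    proof
      fix x assume "x \<in> \<Union>\<U>"
      then obtain U where U: "U \<in> \<U>" "x \<in> U"
        by blast
      show "x \<in> X closure_of \<Union>(u ` M)"
      proof (rule ccontr)
        assume "x \<notin> X closure_of \<Union>(u ` M)"
        moreover have "x \<in> topspace X"
          using U op openin_subset by blast
        ultimately obtain T where T: "x \<in> T" "openin X T" "T \<inter> \<Union>(u ` M) = {}"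
          by (auto simp: in_closure_of)
        have disj: "disjnt (T \<inter> U) W" if "W \<in> M" for W
          using u[OF that] T(3) that unfolding disjnt_def by blast
        have "insert (T \<inter> U) M \<in> D"
          using M T U op disj by (auto simp: D_def pairwise_insert disjnt_sym)
        then have "T \<inter> U \<in> M"
          using max by blast
        then show False
          using disj[of "T \<inter> U"] T U by (auto simp: disjnt_def)
      qed
    qed
  qed
qed

section \<open>The cardinality bound\<close>

lemma first_countable_nbhd_sequence:
  assumes "first_countable X" "x \<in> topspace X"
  obtains N where "\<And>n::nat. openin X (N n)" "\<And>n. x \<in> N n"
    "\<And>U. openin X U \<Longrightarrow> x \<in> U \<Longrightarrow> \<exists>n. N n \<subseteq> U"
proof -
  obtain \<B> where \<B>: "countable \<B>" "\<And>V. V \<in> \<B> \<Longrightarrow> openin X V"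
      "\<And>U. openin X U \<Longrightarrow> x \<in> U \<Longrightarrow> \<exists>V\<in>\<B>. x \<in> V \<and> V \<subseteq> U"
    using assms unfolding first_countable_def by meson
  define \<N> where "\<N> = {V \<in> \<B>. x \<in> V}"
  have "\<N> \<noteq> {}"
    using \<B>(3)[OF openin_topspace assms(2)] by (auto simp: \<N>_def)
  moreover have "countable \<N>"
    using \<B>(1) by (auto simp: \<N>_def)
  ultimately have range: "range (from_nat_into \<N>) = \<N>"
    by (rule range_from_nat_into)
  then have "from_nat_into \<N> n \<in> \<N>" for n
    by blast
  moreover have "\<exists>n. from_nat_into \<N> n \<subseteq> U" if U: "openin X U" "x \<in> U" for U
  proof -
    obtain V where "V \<in> \<N>" "V \<subseteq> U"
      using \<B>(3)[OF U] by (auto simp: \<N>_def)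
    then show ?thesis
      using range by (metis imageE)
  qed
  ultimately show thesis
    using \<B>(2) that[of "from_nat_into \<N>"] by (auto simp: \<N>_def)
qed

theorem Hausdorff_first_countable_ccc_lepoll_continuum:
  fixes X :: "'a topology"
  assumes haus: "Hausdorff_space X" and fc: "first_countable X" and ccc: "ccc_space X"
  shows "topspace X \<lesssim> (UNIV :: nat set set)"
proof (cases "topspace X = {}")
  case True
  then show ?thesis
    by simp
next
  case False
  then obtain a where a: "a \<in> topspace X"
    by blast
  define base where "base x N \<longleftrightarrow>
      (\<forall>n. openin X (N n) \<and> x \<in> N n) \<and> (\<forall>U. openin X U \<and> x \<in> U \<longrightarrow> (\<exists>n. N n \<subseteq> U))"
    for x and N :: "nat \<Rightarrow> 'a set"
  have "\<exists>N. base x N" if "x \<in> topspace X" for x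
    using first_countable_nbhd_sequence[OF fc that] unfolding base_def by metis
  then obtain B where base: "\<And>x. x \<in> topspace X \<Longrightarrow> base x (B x)"
    by metis
  then have B: "\<And>x n. x \<in> topspace X \<Longrightarrow> openin X (B x n) \<and> x \<in> B x n"
    and B_small: "\<And>x U. openin X U \<Longrightarrow> x \<in> U \<Longrightarrow> x \<in> topspace X \<Longrightarrow> \<exists>n. B x n \<subseteq> U"
    unfolding base_def by blast+
  \<comment> \<open>The points \<open>s k\<close> and the set \<open>L\<close> encode the families \<open>{B (s k) j | (n, k, j) \<in> L}\<close>, one for each \<open>n\<close>.\<close>
  define covered where "covered L s =
      (\<Union>n. X closure_of (\<Union>{B (s k) j |k j. (n, k, j) \<in> L}))"
    for L :: "(nat \<times> nat \<times> nat) set" and s :: "nat \<Rightarrow> 'a"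
  define F where "F L s = (if topspace X \<subseteq> covered L s then a else SOME p. p \<in> topspace X - covered L s)"
    for L s
  have F_new: "F L s \<in> topspace X - covered L s" if "\<not> topspace X \<subseteq> covered L s" for L s
  proof -
    have "(SOME p. p \<in> topspace X - covered L s) \<in> topspace X - covered L s"
      using that by (intro someI_ex[where P = "\<lambda>p. p \<in> topspace X - covered L s"]) blast
    then show ?thesis
      using that by (simp add: F_def)
  qed
  obtain H0 where H0: "a \<in> H0" "H0 \<lesssim> (UNIV :: nat set set)"
      and H0_closed: "\<And>L s. range s \<subseteq> H0 \<Longrightarrow> F L s \<in> H0"
    using closed_under_countable_operations[of a F] by blast
  define H where "H = H0 \<inter> topspace X"
  have "topspace X \<subseteq> H"
  proof
    fix p assume p: "p \<in> topspace X"
    show "p \<in> H"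
    proof (rule ccontr)
      assume "p \<notin> H"
      define \<U> where "\<U> n = {B x j |x j. x \<in> H \<and> B x j \<inter> B p n = {}}" for n
      have "\<exists>\<V>. countable \<V> \<and> \<V> \<subseteq> \<U> n \<and> \<Union>(\<U> n) \<subseteq> X closure_of \<Union>\<V>" for n
      proof -
        have "openin X U" if "U \<in> \<U> n" for U
          using that B by (auto simp: \<U>_def H_def)
        then show ?thesis
          using ccc_countable_subfamily_dense[OF ccc] by metis
      qed
      then obtain \<V> where \<V>: "\<And>n. countable (\<V> n)" "\<And>n. \<V> n \<subseteq> \<U> n"
          "\<And>n. \<Union>(\<U> n) \<subseteq> X closure_of \<Union>(\<V> n)"
        by metis
      have "\<forall>V \<in> (\<Union>n. \<V> n). \<exists>x. x \<in> H \<and> V \<in> range (B x)"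
        using \<V>(2) by (fastforce simp: \<U>_def)
      then obtain c where c: "\<And>V. V \<in> (\<Union>n. \<V> n) \<Longrightarrow> c V \<in> H \<and> V \<in> range (B (c V))"
        by metis
      \<comment> \<open>Adding \<open>a\<close> makes the set of centres non-empty, so that it can be enumerated.\<close>
      define C where "C = insert a (c ` (\<Union>n. \<V> n))"
      define s where "s = from_nat_into C"
      have "countable C" "C \<noteq> {}" "C \<subseteq> H"
        using \<V>(1) c a H0(1) by (auto simp: C_def H_def)
      then have s: "range s = C"
        by (simp add: s_def)
      define L where "L = {(n, k, j). B (s k) j \<in> \<V> n}"
      have family: "{B (s k) j |k j. (n, k, j) \<in> L} = \<V> n" for n
      proof
        show "{B (s k) j |k j. (n, k, j) \<in> L} \<subseteq> \<V> n"
          by (auto simp: L_def)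
        show "\<V> n \<subseteq> {B (s k) j |k j. (n, k, j) \<in> L}"
        proof
          fix V assume V: "V \<in> \<V> n"
          then have "c V \<in> range s"
            by (auto simp: s C_def)
          then obtain k where "c V = s k"
            by blast
          moreover obtain j where "V = B (c V) j"
            using c V by blast
          ultimately have "V = B (s k) j"
            by simp
          then show "V \<in> {B (s k) j |k j. (n, k, j) \<in> L}"
            using V by (auto simp: L_def)
        qed
      qed
      then have covered: "covered L s = (\<Union>n. X closure_of \<Union>(\<V> n))"
        by (simp add: covered_def)
      have "H \<subseteq> covered L s"
      proof
        fix x assume x: "x \<in> H"
        then have "x \<in> topspace X" "x \<noteq> p"
          using \<open>p \<notin> H\<close> by (auto simp: H_def)
        then obtain U W where UW: "openin X U" "openin X W" "x \<in> U" "p \<in> W" "disjnt U W"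
          using haus p unfolding Hausdorff_space_def by metis
        obtain j n where "B x j \<subseteq> U" "B p n \<subseteq> W"
          using B_small UW p \<open>x \<in> topspace X\<close> by metis
        then have "B x j \<inter> B p n = {}"
          using UW(5) by (auto simp: disjnt_def)
        then have "B x j \<in> \<U> n"
          using x unfolding \<U>_def by blast
        then show "x \<in> covered L s"
          using \<V>(3) B \<open>x \<in> topspace X\<close> unfolding covered by blast
      qed
      moreover have "p \<notin> X closure_of \<Union>(\<V> n)" for n
      proof -
        have "B p n \<inter> \<Union>(\<V> n) = {}"
          using \<V>(2)[of n] by (auto simp: \<U>_def)
        then show ?thesis
          using B[OF p, of n] by (auto simp: in_closure_of)
      qed
      then have "F L s \<in> topspace X - covered L s"
        using p by (intro F_new) (auto simp: covered)
      moreover have "F L s \<in> H0"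
        using s \<open>C \<subseteq> H\<close> by (intro H0_closed) (auto simp: H_def)
      ultimately show False
        by (auto simp: H_def)
    qed
  qed
  then have "topspace X \<lesssim> H0"
    by (intro subset_imp_lepoll) (auto simp: H_def)
  then show ?thesis
    using H0(2) by (rule lepoll_trans)
qed

theorem theorem3p10:
  fixes X :: "'a topology"
  assumes "Hausdorff_space X"
    and "almost_regular_space X"
    and "first_countable X"
    and "ccc_space X"
  shows "topspace X \<lesssim> (UNIV :: nat set set)"
  using assms(1,3,4) by (rule Hausdorff_first_countable_ccc_lepoll_continuum)

end
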